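(* Let $\{X_C(t)\}_{t\ge 0}$ be the multi-channel activity process on $\mathcal X_C$, let $\{\widetilde X(t)\}_{t\ge 0}$ be the single-channel activity process on the virtual network $G^*$ with state space $\mathcal X^*$, and let $\mathcal V:\mathcal X^*\to\mathcal X_C$ be the map defined in the context. Then for any two distinct states $\mathbf x,\mathbf y\in\mathcal X^*$ the transition rate of $\{\widetilde X(t)\}_{t\ge0}$ from $\mathbf x$ to $\mathbf y$ equals $q_C(\mathcal V(\mathbf x),\mathcal V(\mathbf y))$. Consequently, if $X_C(0)=\mathcal V(\widetilde X(0))$, then $$X_C(t)\overset{d}{=}\mathcal V(\widetilde X(t))\qquad\text{for all } t\ge 0,$$ where $\overset{d}{=}$ denotes equality in distribution.
   Context: Multi-channel model. Let $V=\{1,\dots,N\}$ be a finite set of nodes and $C\ge 1$ the number of channels. For each $c\in\{1,\dots,C\}$ let $G_c=(V,E_c)$ be a simple undirected graph (the conflict graph on channel $c$; the graphs may differ for different $c$). Let $\nu_{i,c}>0$ and $\mu_{i,c}>0$ for $i\in V$, $1\le c\le C$. The set of feasible states is $$\mathcal X_C=\{x\in\{0,1,\dots,C\}^N:\ \text{for every } c\in\{1,\dots,C\}\text{ and every }(i,j)\in E_c,\ \text{not both } x_i=c \text{ and } x_j=c\},$$ where $x_i=0$ means node $i$ is inactive and $x_i=c\geq 1$ means node $i$ is active on channel $c$. The process $\{X_C(t)\}_{t\ge0}$ is the continuous-time Markov process on $\mathcal X_C$ with transition rates, for $x\ne y$ in $\mathcal X_C$: $q_C(x,y)=\nu_{i,c}$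 if $x_i=0$ and $y=x+c\,e_i$; $q_C(x,y)=\mu_{i,c}$ if $x_i=c$ and $y=x-c\,e_i$; $q_C(x,y)=0$ otherwise (here $1\le c\le C$ and $e_i$ is the $i$-th unit vector). Virtual network. $G^*=(V^*,E^* )$ has vertex set $V^*=V\times\{1,\dots,C\}$, and $(i,c)$, $(i',c')$ are adjacent if and only if either $i=i'$ and $c\ne c'$, or $c=c'$ and $(i,i')\in E_c$. $\mathcal X^*\subset\{0,1\}^{V^*}$ is the set of incidence vectors of independent sets of $G^*$. The process $\{\widetilde X(t)\}_{t\ge0}$ is the continuous-time Markov process on $\mathcal X^*$ whose transition rate from $\mathbf x$ to $\mathbf y\neq \mathbf x$ is $\nu_{i,c}$ if $\mathbf y=\mathbf x+e_{(i,c)}$, is $\mu_{i,c}$ if $\mathbf y=\mathbf x-e_{(i,c)}$, and $0$ otherwise. The map $\mathcal V:\mathcal X^*\to\mathcal X_C$ is defined by $\mathcal V(\mathbf x)_i=c$ if there exists $c$ with $\mathbf x_{(i,c)}=1$ (such $c$ is unique), and $\mathcal V(\mathbf x)_i=0$ otherwise. *)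

theory Defs
  imports "HOL-Probability.Probability"
begin

subsection \<open>Graphs and the multi-channel state space\<close>

definition simple_graph :: "'v set \<Rightarrow> ('v \<times> 'v) set \<Rightarrow> bool" where
  "simple_graph V E \<longleftrightarrow> E \<subseteq> V \<times> V \<and> sym E \<and> irrefl E"

definition independent_set :: "'v set \<Rightarrow> ('v \<times> 'v) set \<Rightarrow> 'v set \<Rightarrow> bool" where
  "independent_set V E S \<longleftrightarrow> S \<subseteq> V \<and> (\<forall>u\<in>S. \<forall>v\<in>S. (u, v) \<notin> E)"

text \<open>Vectors indexed by a finite set are functions that vanish outside that set.\<close>

definition feasible_states ::
    "nat \<Rightarrow> nat \<Rightarrow> (nat \<Rightarrow> (nat \<times> nat) set) \<Rightarrow> (nat \<Rightarrow> nat) set" where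
  "feasible_states N C E =
     {x. (\<forall>i\<in>{1..N}. x i \<in> {0..C}) \<and> (\<forall>i. i \<notin> {1..N} \<longrightarrow> x i = 0) \<and>
         (\<forall>c\<in>{1..C}. \<forall>(i, j)\<in>E c. \<not> (x i = c \<and> x j = c))}"

text \<open>The first summand encodes \<open>y = x + c e\<^sub>i\<close>, the second \<open>y = x - c e\<^sub>i\<close> (written as
  \<open>x = y + c e\<^sub>i\<close> to avoid truncated subtraction). For given \<open>x\<close> and \<open>y\<close> at most one of these
  conditions holds, and for at most one pair \<open>(i, c)\<close>, so the sum is a definition by cases.\<close>

definition multi_rate ::
    "nat \<Rightarrow> nat \<Rightarrow> (nat \<Rightarrow> nat \<Rightarrow> real) \<Rightarrow> (nat \<Rightarrow> nat \<Rightarrow> real)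
      \<Rightarrow> (nat \<Rightarrow> nat) \<Rightarrow> (nat \<Rightarrow> nat) \<Rightarrow> real" where
  "multi_rate N C \<nu> \<mu> x y =
     (\<Sum>i\<in>{1..N}. \<Sum>c\<in>{1..C}.
        (if x i = 0 \<and> y = x(i := x i + c) then \<nu> i c else 0) +
        (if x i = c \<and> x = y(i := y i + c) then \<mu> i c else 0))"


subsection \<open>The virtual network\<close>

definition virtual_nodes :: "nat \<Rightarrow> nat \<Rightarrow> (nat \<times> nat) set" where
  "virtual_nodes N C = {1..N} \<times> {1..C}"

definition virtual_edges ::
    "nat \<Rightarrow> nat \<Rightarrow> (nat \<Rightarrow> (nat \<times> nat) set) \<Rightarrow> ((nat \<times> nat) \<times> (nat \<times> nat)) set" where
  "virtual_edges N C E =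
     {((i, c), (i', c')) | i c i' c'.
        (i, c) \<in> virtual_nodes N C \<and> (i', c') \<in> virtual_nodes N C \<and>
        (i = i' \<and> c \<noteq> c' \<or> c = c' \<and> (i, i') \<in> E c)}"

definition virtual_states ::
    "nat \<Rightarrow> nat \<Rightarrow> (nat \<Rightarrow> (nat \<times> nat) set) \<Rightarrow> (nat \<times> nat \<Rightarrow> nat) set" where
  "virtual_states N C E =
     {indicator S | S. independent_set (virtual_nodes N C) (virtual_edges N C E) S}"

text \<open>As for \<^const>\<open>multi_rate\<close>, at most one condition holds, for at most one \<open>(i, c)\<close>.\<close>

definition virtual_rate ::
    "nat \<Rightarrow> nat \<Rightarrow> (nat \<Rightarrow> nat \<Rightarrow> real) \<Rightarrow> (nat \<Rightarrow> nat \<Rightarrow> real)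
      \<Rightarrow> (nat \<times> nat \<Rightarrow> nat) \<Rightarrow> (nat \<times> nat \<Rightarrow> nat) \<Rightarrow> real" where
  "virtual_rate N C \<nu> \<mu> x y =
     (\<Sum>(i, c)\<in>virtual_nodes N C.
        (if y = x((i, c) := x (i, c) + 1) then \<nu> i c else 0) +
        (if x = y((i, c) := y (i, c) + 1) then \<mu> i c else 0))"

definition virtual_map :: "(nat \<times> nat \<Rightarrow> nat) \<Rightarrow> nat \<Rightarrow> nat" where
  "virtual_map x i = (if \<exists>c. x (i, c) = 1 then THE c. x (i, c) = 1 else 0)"

lemma virtual_map_eq:
  assumes "x \<in> virtual_states N C E" and "x (i, c) = 1"
  shows "virtual_map x i = c"
proof -
  obtain S where x: "x = indicator S"
    and S: "independent_set (virtual_nodes N C) (virtual_edges N C E) S"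
    using assms(1) by (auto simp: virtual_states_def)
  have "c' = c" if "x (i, c') = 1" for c'
  proof (rule ccontr)
    assume "c' \<noteq> c"
    moreover have "(i, c) \<in> S" "(i, c') \<in> S"
      using that assms(2) indicator_eq_1_iff unfolding x by metis+
    ultimately show False
      using S unfolding independent_set_def virtual_edges_def by blast
  qed
  then show ?thesis
    using assms(2) unfolding virtual_map_def by (metis (mono_tags, lifting) the_equality)
qed

lemma virtual_map_feasible:
  assumes "x \<in> virtual_states N C E"
  shows "virtual_map x \<in> feasible_states N C E"
proof -
  obtain S where x: "x = indicator S"
    and S: "independent_set (virtual_nodes N C) (virtual_edges N C E) S"
    using assms by (auto simp: virtual_states_def)
  have cases: "virtual_map x i = 0 \<or>
      ((i, virtual_map x i) \<in> S \<and> i \<in> {1..N} \<and> virtual_map x i \<in> {1..C})" for i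
  proof (cases "\<exists>c. x (i, c) = 1")
    case True
    then obtain c where c: "x (i, c) = 1" by blast
    then have "(i, c) \<in> S"
      using indicator_eq_1_iff unfolding x by metis
    then show ?thesis
      using virtual_map_eq[OF assms c] S
      by (auto simp: independent_set_def virtual_nodes_def)
  qed (simp add: virtual_map_def)
  have "\<not> (virtual_map x i = c \<and> virtual_map x j = c)"
    if "c \<in> {1..C}" "(i, j) \<in> E c" for i j c
  proof
    assume "virtual_map x i = c \<and> virtual_map x j = c"
    then have "(i, c) \<in> S" "(j, c) \<in> S"
      using cases[of i] cases[of j] that(1) by force+
    then show False
      using S that(2) unfolding independent_set_def virtual_edges_def by blast
  qed
  moreover have "virtual_map x i \<in> {0..C}" for i
    using cases[of i] by force
  moreover have "virtual_map x i = 0" if "i \<notin> {1..N}" for i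
    using cases[of i] that by blast
  ultimately show ?thesis
    unfolding feasible_states_def by blast
qed


subsection \<open>Continuous-time Markov processes on a finite state space\<close>

text \<open>\<open>P t x y\<close> is a transition function on \<open>S\<close> with transition rates \<open>q x y\<close> for \<open>x \<noteq> y\<close>, that
  is, \<open>P h x y = q x y * h + o(h)\<close> as \<open>h\<close> decreases to \<open>0\<close>. The values \<open>q x x\<close> are not used.\<close>

definition transition_function ::
    "'s set \<Rightarrow> ('s \<Rightarrow> 's \<Rightarrow> real) \<Rightarrow> (real \<Rightarrow> 's \<Rightarrow> 's \<Rightarrow> real) \<Rightarrow> bool" where
  "transition_function S q P \<longleftrightarrow>
     (\<forall>t\<ge>0. \<forall>x\<in>S. \<forall>y\<in>S. 0 \<le> P t x y) \<and>
     (\<forall>t\<ge>0. \<forall>x\<in>S. (\<Sum>y\<in>S. P t x y) = 1) \<and>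
     (\<forall>x\<in>S. \<forall>y\<in>S. P 0 x y = (if x = y then 1 else 0)) \<and>
     (\<forall>s\<ge>0. \<forall>t\<ge>0. \<forall>x\<in>S. \<forall>z\<in>S. P (s + t) x z = (\<Sum>y\<in>S. P s x y * P t y z)) \<and>
     (\<forall>x\<in>S. \<forall>y\<in>S. x \<noteq> y \<longrightarrow> ((\<lambda>h. P h x y / h) \<longlongrightarrow> q x y) (at_right 0))"

text \<open>No regularity of sample paths is required: it does not affect the finite-dimensional
  distributions.\<close>

definition markov_process ::
    "'w measure \<Rightarrow> 's set \<Rightarrow> ('s \<Rightarrow> 's \<Rightarrow> real) \<Rightarrow> (real \<Rightarrow> 'w \<Rightarrow> 's) \<Rightarrow> bool" where
  "markov_process M S q X \<longleftrightarrow>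
     prob_space M \<and> finite S \<and>
     (\<forall>t\<ge>0. X t \<in> measurable M (count_space S)) \<and>
     (\<exists>P. transition_function S q P \<and>
       (\<forall>(n::nat) (t :: nat \<Rightarrow> real) x.
          0 \<le> t 0 \<and> (\<forall>k\<le>n. t k < t (Suc k)) \<and> (\<forall>k\<le>Suc n. x k \<in> S) \<and>
          \<P>(\<omega> in M. \<forall>k\<le>n. X (t k) \<omega> = x k) > 0 \<longrightarrow>
          \<P>(\<omega> in M. X (t (Suc n)) \<omega> = x (Suc n) \<bar> \<forall>k\<le>n. X (t k) \<omega> = x k)
            = P (t (Suc n) - t n) (x n) (x (Suc n))))"

end

theory Submission
  imports Defs
begin

text \<open>Off-diagonal rates determine a transition function on a finite set: for two of them the
  difference is \<open>o(h)\<close> as \<open>h\<close> decreases to \<open>0\<close> (on the diagonal because rows sum to one), and as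
  stochastic matrices are contractions, telescoping gives
  \<open>\<parallel>P t - Q t\<parallel> \<le> n \<parallel>P (t/n) - Q (t/n)\<parallel>\<close>, which tends to \<open>0\<close> as \<open>n\<close> grows. Since the virtual map is
  a bijection of state spaces preserving the rates, it identifies the transition functions and
  hence the marginal laws.\<close>

subsection \<open>The virtual map is a rate-preserving bijection\<close>

text \<open>The guard \<open>c \<noteq> 0\<close> keeps an inactive node, where
  \<open>u i = 0\<close>, from marking the pair \<open>(i, 0)\<close>, which is not a virtual
  node.\<close>

definition virtual_inverse :: "(nat \<Rightarrow> nat) \<Rightarrow> nat \<times> nat \<Rightarrow> nat" where
  "virtual_inverse u = (\<lambda>(i, c). if c \<noteq> 0 \<and> u i = c then 1 else 0)"

lemma virtual_inverse_virtual_map: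
  assumes "x \<in> virtual_states N C E"
  shows "virtual_inverse (virtual_map x) = x"
proof
  fix p :: "nat \<times> nat"
  obtain i c where p: "p = (i, c)" by fastforce
  obtain S where x: "x = indicator S"
    and S: "independent_set (virtual_nodes N C) (virtual_edges N C E) S"
    using assms by (auto simp: virtual_states_def)
  show "virtual_inverse (virtual_map x) p = x p"
  proof (cases "x (i, c) = 1")
    case True
    then have "(i, c) \<in> S" using indicator_eq_1_iff unfolding x by metis
    then have "c \<noteq> 0" using S by (auto simp: independent_set_def virtual_nodes_def)
    then show ?thesis
      using True virtual_map_eq[OF assms True] by (simp add: p virtual_inverse_def)
  next
    case False
    then have 0: "x (i, c) = 0" by (auto simp: x indicator_def split: if_splits)
    have "\<not> (c \<noteq> 0 \<and> virtual_map x i = c)"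
    proof
      assume *: "c \<noteq> 0 \<and> virtual_map x i = c"
      \<comment> \<open>A nonzero value of \<open>virtual_map\<close> is not the default 0, so it
        comes from some active channel; uniqueness of that channel identifies it with
        \<open>c\<close>.\<close>
      then obtain c' where "x (i, c') = 1" by (auto simp: virtual_map_def split: if_splits)
      with virtual_map_eq[OF assms this] * False show False by simp
    qed
    with 0 show ?thesis by (simp add: p virtual_inverse_def)
  qed
qed

lemma virtual_map_virtual_inverse: "virtual_map (virtual_inverse u) = u"
proof
  fix i show "virtual_map (virtual_inverse u) i = u i"
    by (auto simp: virtual_map_def virtual_inverse_def)
qed

text \<open>An edge between two marked virtual nodes cannot join two channels of one node, because
  \<open>u\<close> has a single value there; an edge inside a channel is what feasibility
  forbids.\<close>

lemma virtual_inverse_in_virtual_states: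
  assumes "u \<in> feasible_states N C E"
  shows "virtual_inverse u \<in> virtual_states N C E"
proof -
  define S where "S = {(i, c). c \<noteq> 0 \<and> u i = c}"
  have eq: "virtual_inverse u = indicator S"
    by (auto simp: virtual_inverse_def S_def indicator_def)
  have range: "i \<in> {1..N} \<and> u i \<in> {1..C}" if "u i \<noteq> 0" for i
  proof -
    have "\<forall>i\<in>{1..N}. u i \<in> {0..C}" "\<forall>i. i \<notin> {1..N} \<longrightarrow> u i = 0"
      using assms by (simp_all add: feasible_states_def)
    moreover from this that have "i \<in> {1..N}" by metis
    ultimately show ?thesis using that by (simp add: Suc_le_eq)
  qed
  then have "S \<subseteq> virtual_nodes N C"
    unfolding S_def virtual_nodes_def by auto
  moreover have "(p, p') \<notin> virtual_edges N C E" if "p \<in> S" "p' \<in> S" for p p'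
  proof
    assume "(p, p') \<in> virtual_edges N C E"
    then obtain i c i' c' where *: "p = (i, c)" "p' = (i', c')"
      "c \<in> {1..C}" "i = i' \<and> c \<noteq> c' \<or> c = c' \<and> (i, i') \<in> E c"
      unfolding virtual_edges_def virtual_nodes_def by blast
    with that have "u i = c" "u i' = c'" by (auto simp: S_def)
    moreover from this have "c = c'" "(i, i') \<in> E c" using * by auto
    moreover have "\<forall>c\<in>{1..C}. \<forall>(i, j)\<in>E c. \<not> (u i = c \<and> u j = c)"
      using assms by (simp add: feasible_states_def)
    ultimately show False using *(3) by fastforce
  qed
  ultimately have "independent_set (virtual_nodes N C) (virtual_edges N C E) S"
    by (auto simp: independent_set_def)
  then show ?thesis unfolding virtual_states_def eq by blast
qed

text \<open>Stated for the inverse because transition functions will be compared on the feasible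
  states, to which that of the virtual network is pulled back along this map.\<close>

lemma bij_betw_virtual_inverse:
  "bij_betw virtual_inverse (feasible_states N C E) (virtual_states N C E)"
proof (rule bij_betw_byWitness[where f' = virtual_map])
  show "\<forall>x\<in>virtual_states N C E. virtual_inverse (virtual_map x) = x"
    by (blast intro: virtual_inverse_virtual_map)
  show "virtual_inverse ` feasible_states N C E \<subseteq> virtual_states N C E"
    by (blast intro: virtual_inverse_in_virtual_states)
  show "virtual_map ` virtual_states N C E \<subseteq> feasible_states N C E"
    by (blast intro: virtual_map_feasible)
qed (simp add: virtual_map_virtual_inverse)

text \<open>Treats activations only. A deactivation from \<open>x\<close> to \<open>y\<close> is an
  activation from \<open>y\<close> to \<open>x\<close>, so the same equivalence with the states
  exchanged covers it.\<close>

lemma virtual_step_iff: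
  assumes x: "x \<in> virtual_states N C E" and y: "y \<in> virtual_states N C E" and c: "c \<noteq> 0"
  shows "y = x((i, c) := x (i, c) + 1) \<longleftrightarrow>
    virtual_map x i = 0 \<and> virtual_map y = (virtual_map x)(i := virtual_map x i + c)"
proof -
  define u v where "u = virtual_map x" and "v = virtual_map y"
  have xu: "x = virtual_inverse u" and yv: "y = virtual_inverse v"
    using virtual_inverse_virtual_map[OF x] virtual_inverse_virtual_map[OF y]
    by (simp_all add: u_def v_def)
  have "virtual_inverse v = (virtual_inverse u)((i, c) := virtual_inverse u (i, c) + 1) \<longleftrightarrow>
    u i = 0 \<and> v = u(i := u i + c)" (is "?L \<longleftrightarrow> ?R")
  proof
    assume ?L
    then have L: "virtual_inverse v (j, d) =
        virtual_inverse u (j, d) + (if j = i \<and> d = c then 1 else 0)" for j d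
      by simp
    \<comment> \<open>Values are at most 1, so an increment at \<open>(i, c)\<close> must go from 0
      to 1.\<close>
    have vi: "v i = c" and uc: "u i \<noteq> c"
      using L[of i c] c by (auto simp: virtual_inverse_def split: if_splits)
    \<comment> \<open>Were \<open>u i\<close> nonzero, the coordinate \<open>(i, u i)\<close>,
      distinct from \<open>(i, c)\<close>, would stay 1 and force \<open>v i = u i\<close>,
      contradicting \<open>v i = c\<close>.\<close>
    have "u i = 0"
      using L[of i "u i"] vi uc by (auto simp: virtual_inverse_def split: if_splits)
    moreover have "v j = u j" if "j \<noteq> i" for j
    proof -
      \<comment> \<open>Agreement on all nonzero \<open>d\<close> suffices: the value is 0 exactly
        when no such \<open>d\<close> fits.\<close>
      have "d \<noteq> 0 \<and> v j = d \<longleftrightarrow> d \<noteq> 0 \<and> u j = d" for d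
        using L[of j d] that by (auto simp: virtual_inverse_def split: if_splits)
      then show ?thesis by metis
    qed
    ultimately show ?R using vi by auto
  next
    assume ?R
    then show ?L using c by (auto simp: virtual_inverse_def fun_eq_iff)
  qed
  then show ?thesis by (simp only: xu yv virtual_map_virtual_inverse)
qed

lemma virtual_rate_eq_multi_rate:
  assumes x: "x \<in> virtual_states N C E" and y: "y \<in> virtual_states N C E"
  shows "virtual_rate N C \<nu> \<mu> x y = multi_rate N C \<nu> \<mu> (virtual_map x) (virtual_map y)"
proof -
  have "virtual_rate N C \<nu> \<mu> x y = (\<Sum>(i, c)\<in>{1..N} \<times> {1..C}.
        (if virtual_map x i = 0 \<and> virtual_map y = (virtual_map x)(i := virtual_map x i + c)
          then \<nu> i c else 0) +
        (if virtual_map x i = c \<and> virtual_map x = (virtual_map y)(i := virtual_map y i + c)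
          then \<mu> i c else 0))"
    unfolding virtual_rate_def virtual_nodes_def
  proof (rule sum.cong[OF refl], clarify)
    fix i c assume "c \<in> {1..C}"
    then have c: "c \<noteq> 0" by simp
    \<comment> \<open>\<open>multi_rate\<close> phrases a departure as \<open>x i = c\<close>, the
      exchanged step lemma as \<open>y i = 0\<close>; given that the states differ by
      \<open>c\<close> at \<open>i\<close>, these agree.\<close>
    have "virtual_map y i = 0 \<and> virtual_map x = (virtual_map y)(i := virtual_map y i + c) \<longleftrightarrow>
      virtual_map x i = c \<and> virtual_map x = (virtual_map y)(i := virtual_map y i + c)"
      by (auto simp: fun_eq_iff)
    then show "(if y = x((i, c) := x (i, c) + 1) then \<nu> i c else 0) +
        (if x = y((i, c) := y (i, c) + 1) then \<mu> i c else 0) =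
        (if virtual_map x i = 0 \<and> virtual_map y = (virtual_map x)(i := virtual_map x i + c)
          then \<nu> i c else 0) +
        (if virtual_map x i = c \<and> virtual_map x = (virtual_map y)(i := virtual_map y i + c)
          then \<mu> i c else 0)"
      by (simp only: virtual_step_iff[OF x y c] virtual_step_iff[OF y x c])
  qed
  then show ?thesis
    unfolding multi_rate_def by (simp add: sum.cartesian_product)
qed


subsection \<open>Transition functions\<close>

lemma transition_functionD:
  assumes "transition_function S q P"
  shows transition_function_nonneg: "0 \<le> t \<Longrightarrow> x \<in> S \<Longrightarrow> y \<in> S \<Longrightarrow> 0 \<le> P t x y"
    and transition_function_sum: "0 \<le> t \<Longrightarrow> x \<in> S \<Longrightarrow> (\<Sum>y\<in>S. P t x y) = 1"
    and transition_function_0: "x \<in> S \<Longrightarrow> y \<in> S \<Longrightarrow> P 0 x y = (if x = y then 1 else 0)"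
    and transition_function_add: "0 \<le> s \<Longrightarrow> 0 \<le> t \<Longrightarrow> x \<in> S \<Longrightarrow> z \<in> S \<Longrightarrow>
      P (s + t) x z = (\<Sum>y\<in>S. P s x y * P t y z)"
    and transition_function_rate: "x \<in> S \<Longrightarrow> y \<in> S \<Longrightarrow> x \<noteq> y \<Longrightarrow>
      ((\<lambda>h. P h x y / h) \<longlongrightarrow> q x y) (at_right 0)"
proof -
  note P = assms[unfolded transition_function_def]
  note c = P[THEN conjunct2]
  note d = c[THEN conjunct2]
  note e = d[THEN conjunct2]
  show "0 \<le> t \<Longrightarrow> x \<in> S \<Longrightarrow> y \<in> S \<Longrightarrow> 0 \<le> P t x y"
    using P[THEN conjunct1] by blast
  show "0 \<le> t \<Longrightarrow> x \<in> S \<Longrightarrow> (\<Sum>y\<in>S. P t x y) = 1"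
    using c[THEN conjunct1] by blast
  show "x \<in> S \<Longrightarrow> y \<in> S \<Longrightarrow> P 0 x y = (if x = y then 1 else 0)"
    using d[THEN conjunct1] by blast
  show "0 \<le> s \<Longrightarrow> 0 \<le> t \<Longrightarrow> x \<in> S \<Longrightarrow> z \<in> S \<Longrightarrow> P (s + t) x z = (\<Sum>y\<in>S. P s x y * P t y z)"
    using e[THEN conjunct1] by blast
  show "x \<in> S \<Longrightarrow> y \<in> S \<Longrightarrow> x \<noteq> y \<Longrightarrow> ((\<lambda>h. P h x y / h) \<longlongrightarrow> q x y) (at_right 0)"
    using e[THEN conjunct2] by blast
qed

text \<open>Relabelling states by a bijection only permutes the terms of the row sums and of the
  Chapman-Kolmogorov sums. This places both transition functions on one state space.\<close>

lemma transition_function_reindex: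
  assumes P: "transition_function S' q' P" and g: "bij_betw g S S'"
  shows "transition_function S (\<lambda>x y. q' (g x) (g y)) (\<lambda>t x y. P t (g x) (g y))"
proof -
  have gS: "g x \<in> S'" if "x \<in> S" for x using g that by (auto simp: bij_betw_def)
  have inj: "g x = g y \<longleftrightarrow> x = y" if "x \<in> S" "y \<in> S" for x y
    using g that by (auto simp: bij_betw_def inj_on_def)
  have sum: "(\<Sum>y\<in>S. f (g y)) = (\<Sum>y\<in>S'. f y)" for f :: "_ \<Rightarrow> real"
    by (rule sum.reindex_bij_betw[OF g])
  show ?thesis
    unfolding transition_function_def
  proof (intro conjI allI ballI impI)
    fix s t :: real and x z assume "s \<ge> 0" "t \<ge> 0" "x \<in> S" "z \<in> S"
    then show "P (s + t) (g x) (g z) = (\<Sum>y\<in>S. P s (g x) (g y) * P t (g y) (g z))"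
      using sum[of "\<lambda>y. P s (g x) y * P t y (g z)"] transition_function_add[OF P] gS by simp
  next
    fix t :: real and x assume "t \<ge> 0" "x \<in> S"
    then show "(\<Sum>y\<in>S. P t (g x) (g y)) = 1"
      using sum[of "P t (g x)"] transition_function_sum[OF P] gS by simp
  qed (use transition_functionD[OF P] gS inj in auto)
qed

section \<open>Uniqueness of the transition function with given off-diagonal rates\<close>

lemma transition_function_diff_add_le:
  assumes P: "transition_function S q P" and Q: "transition_function S q' Q"
    and st: "s \<ge> 0" "t \<ge> 0" and x: "x \<in> S"
    and b: "\<And>y. y \<in> S \<Longrightarrow> (\<Sum>z\<in>S. \<bar>P t y z - Q t y z\<bar>) \<le> b"
  shows "(\<Sum>z\<in>S. \<bar>P (s + t) x z - Q (s + t) x z\<bar>) \<le> b + (\<Sum>z\<in>S. \<bar>P s x z - Q s x z\<bar>)"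
proof -
  have "\<bar>P (s + t) x z - Q (s + t) x z\<bar> \<le>
      (\<Sum>y\<in>S. P s x y * \<bar>P t y z - Q t y z\<bar> + \<bar>P s x y - Q s x y\<bar> * Q t y z)"
    if z: "z \<in> S" for z
  proof -
    \<comment> \<open>Inserting the mixed product: in matrix form,
      \<open>P (s + t) - Q (s + t)\<close> is
      \<open>P s (P t - Q t) + (P s - Q s) Q t\<close>.\<close>
    have eq: "P (s + t) x z - Q (s + t) x z =
        (\<Sum>y\<in>S. P s x y * (P t y z - Q t y z) + (P s x y - Q s x y) * Q t y z)"
      using transition_function_add[OF P st x z] transition_function_add[OF Q st x z]
      by (simp add: sum_subtractf[symmetric] algebra_simps)
    have "\<bar>P (s + t) x z - Q (s + t) x z\<bar> \<le>
        (\<Sum>y\<in>S. \<bar>P s x y * (P t y z - Q t y z) + (P s x y - Q s x y) * Q t y z\<bar>)"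
      unfolding eq by (rule sum_abs)
    also have "\<dots> \<le> (\<Sum>y\<in>S. P s x y * \<bar>P t y z - Q t y z\<bar> + \<bar>P s x y - Q s x y\<bar> * Q t y z)"
    proof (rule sum_mono)
      fix y assume y: "y \<in> S"
      have "\<bar>P s x y\<bar> = P s x y" "\<bar>Q t y z\<bar> = Q t y z"
        using transition_function_nonneg[OF P st(1) x y]
          transition_function_nonneg[OF Q st(2) y z] by simp_all
      then show "\<bar>P s x y * (P t y z - Q t y z) + (P s x y - Q s x y) * Q t y z\<bar> \<le>
          P s x y * \<bar>P t y z - Q t y z\<bar> + \<bar>P s x y - Q s x y\<bar> * Q t y z"
        using abs_triangle_ineq[of "P s x y * (P t y z - Q t y z)" "(P s x y - Q s x y) * Q t y z"]
        by (simp add: abs_mult)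
    qed
    finally show ?thesis .
  qed
  then have "(\<Sum>z\<in>S. \<bar>P (s + t) x z - Q (s + t) x z\<bar>) \<le>
      (\<Sum>z\<in>S. \<Sum>y\<in>S. P s x y * \<bar>P t y z - Q t y z\<bar> + \<bar>P s x y - Q s x y\<bar> * Q t y z)"
    by (rule sum_mono)
  also have "\<dots> =
      (\<Sum>y\<in>S. \<Sum>z\<in>S. P s x y * \<bar>P t y z - Q t y z\<bar> + \<bar>P s x y - Q s x y\<bar> * Q t y z)"
    by (rule sum.swap)
  \<comment> \<open>Summing over \<open>z\<close> first removes \<open>Q t\<close>, whose rows sum
    to one.\<close>
  also have "\<dots> = (\<Sum>y\<in>S. P s x y * (\<Sum>z\<in>S. \<bar>P t y z - Q t y z\<bar>) + \<bar>P s x y - Q s x y\<bar>)"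
    using transition_function_sum[OF Q st(2)]
    by (simp add: sum.distrib sum_distrib_left[symmetric])
  \<comment> \<open>Row \<open>x\<close> of \<open>P s\<close> is a probability vector, so it
    averages the row bounds \<open>b\<close> to at most \<open>b\<close>.\<close>
  also have "\<dots> \<le> (\<Sum>y\<in>S. P s x y * b + \<bar>P s x y - Q s x y\<bar>)"
    by (intro sum_mono add_right_mono mult_left_mono b transition_function_nonneg[OF P st(1) x])
  also have "\<dots> = b + (\<Sum>z\<in>S. \<bar>P s x z - Q s x z\<bar>)"
    using transition_function_sum[OF P st(1) x]
    by (simp add: sum.distrib sum_distrib_right[symmetric])
  finally show ?thesis .
qed

text \<open>Each further factor of length \<open>h\<close> adds at most one error term. The sum over
  all rows stands in for the maximal row sum: it bounds every row and passes easily to limits. The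
  induction varies \<open>x\<close> because the previous lemma needs the bound for all rows.\<close>

lemma transition_function_diff_multiple_le:
  assumes S: "finite S" and P: "transition_function S q P" and Q: "transition_function S q' Q"
    and h: "h \<ge> 0" and x: "x \<in> S"
  shows "(\<Sum>z\<in>S. \<bar>P (real n * h) x z - Q (real n * h) x z\<bar>) \<le>
    real n * (\<Sum>y\<in>S. \<Sum>z\<in>S. \<bar>P h y z - Q h y z\<bar>)"
  using x
proof (induction n arbitrary: x)
  case 0
  then show ?case
    using transition_function_0[OF P] transition_function_0[OF Q] by simp
next
  case (Suc n)
  let ?d = "\<Sum>y\<in>S. \<Sum>z\<in>S. \<bar>P h y z - Q h y z\<bar>"
  have "(\<Sum>z\<in>S. \<bar>P (h + real n * h) x z - Q (h + real n * h) x z\<bar>) \<le>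
      real n * ?d + (\<Sum>z\<in>S. \<bar>P h x z - Q h x z\<bar>)"
    using h Suc.IH
    by (intro transition_function_diff_add_le[OF P Q _ _ Suc.prems]) auto
  also have "(\<Sum>z\<in>S. \<bar>P h x z - Q h x z\<bar>) \<le> ?d"
    using S Suc.prems
    by (intro member_le_sum[where f = "\<lambda>y. \<Sum>z\<in>S. \<bar>P h y z - Q h y z\<bar>"])
      (auto intro: sum_nonneg)
  finally show ?case by (simp add: algebra_simps)
qed

text \<open>Off the diagonal both quotients tend to the same rate. On the diagonal no rate is
  prescribed, but rows summing to one make that difference minus the sum of the others.\<close>

lemma transition_function_diff_tendsto_0:
  assumes S: "finite S" and P: "transition_function S q P" and Q: "transition_function S q' Q"
    and q: "\<And>x y. x \<in> S \<Longrightarrow> y \<in> S \<Longrightarrow> x \<noteq> y \<Longrightarrow> q x y = q' x y"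
    and x: "x \<in> S" and y: "y \<in> S"
  shows "((\<lambda>h. (P h x y - Q h x y) / h) \<longlongrightarrow> 0) (at_right 0)"
proof -
  have off: "((\<lambda>h. (P h x z - Q h x z) / h) \<longlongrightarrow> 0) (at_right 0)" if "z \<in> S" "x \<noteq> z" for z
    using tendsto_diff[OF transition_function_rate[OF P x that] transition_function_rate[OF Q x that]]
    by (simp add: q[OF x that] diff_divide_distrib)
  show ?thesis
  proof (cases "x = y")
    case True
    have "((\<lambda>h. - (\<Sum>z\<in>S - {x}. (P h x z - Q h x z) / h)) \<longlongrightarrow> - (\<Sum>z\<in>S - {x}. 0)) (at_right 0)"
      using off by (intro tendsto_minus tendsto_sum) auto
    then have lim: "((\<lambda>h. - (\<Sum>z\<in>S - {x}. (P h x z - Q h x z) / h)) \<longlongrightarrow> 0) (at_right 0)"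
      by simp
    have "\<forall>\<^sub>F h in at_right 0. - (\<Sum>z\<in>S - {x}. (P h x z - Q h x z) / h) = (P h x x - Q h x x) / h"
      using eventually_at_right_less[of 0]
    proof eventually_elim
      case (elim h)
      have "(\<Sum>z\<in>S. P h x z - Q h x z) = 0"
        using transition_function_sum[OF P _ x, of h] transition_function_sum[OF Q _ x, of h] elim
        by (simp add: sum_subtractf)
      then have "(P h x x - Q h x x) = - (\<Sum>z\<in>S - {x}. P h x z - Q h x z)"
        using sum.remove[OF S x, of "\<lambda>z. P h x z - Q h x z"] by simp
      then show ?case by (simp add: sum_divide_distrib[symmetric])
    qed
    from Lim_transform_eventually[OF lim this] show ?thesis using True by simp
  qed (use off y in blast)
qed

lemma transition_function_unique:
  assumes S: "finite S" and P: "transition_function S q P" and Q: "transition_function S q' Q"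
    and q: "\<And>x y. x \<in> S \<Longrightarrow> y \<in> S \<Longrightarrow> x \<noteq> y \<Longrightarrow> q x y = q' x y"
    and t: "t \<ge> 0" and x: "x \<in> S" and z: "z \<in> S"
  shows "P t x z = Q t x z"
\<comment> \<open>For \<open>t = 0\<close> the step lengths below would be 0 and would not approach
  0 from the right.\<close>
proof (cases "t = 0")
  case True
  then show ?thesis using transition_function_0[OF P x z] transition_function_0[OF Q x z] by simp
next
  case False
  with t have t: "t > 0" by simp
  let ?d = "\<lambda>h. \<Sum>y\<in>S. \<Sum>z\<in>S. \<bar>P h y z - Q h y z\<bar>"
  let ?h = "\<lambda>n. t / real (Suc n)"
  have "((\<lambda>h. \<Sum>y\<in>S. \<Sum>z\<in>S. \<bar>(P h y z - Q h y z) / h\<bar>) \<longlongrightarrow> (\<Sum>y\<in>S. \<Sum>z\<in>S. 0)) (at_right 0)"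
    by (intro tendsto_sum tendsto_rabs_zero transition_function_diff_tendsto_0[OF S P Q q])
  moreover have "filterlim ?h (at_right 0) sequentially"
    using t by real_asymp
  ultimately have "(\<lambda>n. \<Sum>y\<in>S. \<Sum>z\<in>S. \<bar>(P (?h n) y z - Q (?h n) y z) / ?h n\<bar>) \<longlonglongrightarrow> 0"
    using filterlim_compose by fastforce
  then have "(\<lambda>n. t * (\<Sum>y\<in>S. \<Sum>z\<in>S. \<bar>(P (?h n) y z - Q (?h n) y z) / ?h n\<bar>)) \<longlonglongrightarrow> 0"
    by (rule tendsto_mult_right_zero)
  moreover have "\<bar>P t x z - Q t x z\<bar> \<le>
      t * (\<Sum>y\<in>S. \<Sum>z\<in>S. \<bar>(P (?h n) y z - Q (?h n) y z) / ?h n\<bar>)" for n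
  proof -
    have h: "?h n > 0" and nh: "real (Suc n) * ?h n = t" using t by simp_all
    have "\<bar>P t x z - Q t x z\<bar> \<le> (\<Sum>z\<in>S. \<bar>P t x z - Q t x z\<bar>)"
      using S z by (intro member_le_sum[where f = "\<lambda>z. \<bar>P t x z - Q t x z\<bar>"]) auto
    also have "\<dots> \<le> real (Suc n) * ?d (?h n)"
      using transition_function_diff_multiple_le[OF S P Q less_imp_le[OF h] x, of "Suc n"]
      unfolding nh .
    \<comment> \<open>The number of steps \<open>Suc n\<close> equals \<open>t\<close> divided by
      the step length, so the bound becomes \<open>t\<close> times difference quotients.\<close>
    also have "\<dots> = t * (?d (?h n) / ?h n)" using t by simp
    also have "?d (?h n) / ?h n = (\<Sum>y\<in>S. \<Sum>z\<in>S. \<bar>(P (?h n) y z - Q (?h n) y z) / ?h n\<bar>)"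
    proof -
      have "\<bar>a / ?h n\<bar> = \<bar>a\<bar> / ?h n" for a
        using abs_of_pos[OF h] by (simp only: abs_divide[of a])
      then show ?thesis by (simp only: sum_divide_distrib)
    qed
    finally show ?thesis .
  qed
  \<comment> \<open>The left side is constant in \<open>n\<close>, while its bounds tend to
    0.\<close>
  ultimately have "\<bar>P t x z - Q t x z\<bar> \<le> 0"
    by (intro LIMSEQ_le_const) auto
  then show ?thesis by simp
qed


subsection \<open>Marginal laws\<close>

lemma markov_processD:
  assumes "markov_process M S q X"
  shows markov_process_prob_space: "prob_space M"
    and markov_process_finite: "finite S"
    and markov_process_measurable: "t \<ge> 0 \<Longrightarrow> X t \<in> measurable M (count_space S)"
proof -
  note X = assms[unfolded markov_process_def]
  show "prob_space M" by (rule X[THEN conjunct1])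
  show "finite S" by (rule X[THEN conjunct2, THEN conjunct1])
  show "t \<ge> 0 \<Longrightarrow> X t \<in> measurable M (count_space S)"
    using X[THEN conjunct2, THEN conjunct2, THEN conjunct1] by blast
qed

text \<open>Total probability over the state at time 0: the law at time \<open>t\<close> is the
  initial law multiplied by the matrix \<open>P t\<close>.\<close>

lemma markov_process_marginal:
  assumes X: "markov_process M S q X"
  obtains P where "transition_function S q P"
    and "\<And>t y. t \<ge> 0 \<Longrightarrow> y \<in> S \<Longrightarrow> measure M {\<omega>\<in>space M. X t \<omega> = y} =
      (\<Sum>x\<in>S. measure M {\<omega>\<in>space M. X 0 \<omega> = x} * P t x y)"
proof -
  interpret prob_space M by (rule markov_process_prob_space[OF X])
  note S = markov_process_finite[OF X] and meas = markov_process_measurable[OF X]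
  obtain P where P: "transition_function S q P"
    and markov: "\<And>(n::nat) (t :: nat \<Rightarrow> real) x.
          0 \<le> t 0 \<and> (\<forall>k\<le>n. t k < t (Suc k)) \<and> (\<forall>k\<le>Suc n. x k \<in> S) \<and>
          \<P>(\<omega> in M. \<forall>k\<le>n. X (t k) \<omega> = x k) > 0 \<Longrightarrow>
          \<P>(\<omega> in M. X (t (Suc n)) \<omega> = x (Suc n) \<bar> \<forall>k\<le>n. X (t k) \<omega> = x k)
            = P (t (Suc n) - t n) (x n) (x (Suc n))"
    using X unfolding markov_process_def by blast
  have ev: "{\<omega>\<in>space M. X t \<omega> = x} \<in> events" if "t \<ge> 0" "x \<in> S" for t x
  proof -
    have "{\<omega>\<in>space M. X t \<omega> = x} = X t -` {x} \<inter> space M" by auto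
    then show ?thesis using measurable_sets[OF meas[OF that(1)], of "{x}"] that(2) by simp
  qed
  have joint: "prob {\<omega>\<in>space M. X t \<omega> = y \<and> X 0 \<omega> = x} = prob {\<omega>\<in>space M. X 0 \<omega> = x} * P t x y"
    if t: "t > 0" and x: "x \<in> S" and y: "y \<in> S" for t x y
  proof (cases "prob {\<omega>\<in>space M. X 0 \<omega> = x} > 0")
    case True
    have "\<P>(\<omega> in M. X t \<omega> = y \<bar> X 0 \<omega> = x) = P t x y"
      \<comment> \<open>The case of a single conditioning time: index 0 carries time 0 and state
        \<open>x\<close>, index 1 carries time \<open>t\<close> and state \<open>y\<close>.\<close>
      using markov[of "\<lambda>k. if k = 0 then 0 else if k = 1 then t else t + 1" 0
          "\<lambda>k. if k = 0 then x else y"] True t x y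
      by simp
    with True show ?thesis by (simp add: cond_prob_def field_simps)
  next
    case False
    \<comment> \<open>From a null initial state the Markov property says nothing, but both sides
      vanish.\<close>
    then have 0: "prob {\<omega>\<in>space M. X 0 \<omega> = x} = 0" by (simp add: zero_less_measure_iff)
    have "prob {\<omega>\<in>space M. X t \<omega> = y \<and> X 0 \<omega> = x} \<le> prob {\<omega>\<in>space M. X 0 \<omega> = x}"
      using ev[of 0 x] x by (intro finite_measure_mono) auto
    with 0 show ?thesis by (simp add: measure_le_0_iff)
  qed
  have "prob {\<omega>\<in>space M. X t \<omega> = y} = (\<Sum>x\<in>S. prob {\<omega>\<in>space M. X 0 \<omega> = x} * P t x y)"
    if t: "t \<ge> 0" and y: "y \<in> S" for t y
  \<comment> \<open>The Markov property compares strictly increasing times, so time 0 is handled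
    through \<open>P 0\<close>, the identity matrix.\<close>
  proof (cases "t = 0")
    case True
    then have "(\<Sum>x\<in>S. prob {\<omega>\<in>space M. X 0 \<omega> = x} * P t x y) =
        (\<Sum>x\<in>S. if x = y then prob {\<omega>\<in>space M. X 0 \<omega> = x} else 0)"
      using transition_function_0[OF P _ y] by (intro sum.cong) auto
    also have "\<dots> = prob {\<omega>\<in>space M. X 0 \<omega> = y}" using S y by simp
    finally show ?thesis using True by simp
  next
    case False
    with t have t: "t > 0" by simp
    have X0: "X 0 \<omega> \<in> S" if "\<omega> \<in> space M" for \<omega>
      using measurable_space[OF meas[of 0] that] by simp
    have ev2: "{\<omega>\<in>space M. X t \<omega> = y \<and> X 0 \<omega> = x} \<in> events" if "x \<in> S" for x
    proof -
      have "{\<omega>\<in>space M. X t \<omega> = y \<and> X 0 \<omega> = x} =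
          {\<omega>\<in>space M. X t \<omega> = y} \<inter> {\<omega>\<in>space M. X 0 \<omega> = x}" by auto
      then show ?thesis using ev[of t y] ev[of 0 x] t y that by auto
    qed
    have "{\<omega>\<in>space M. X t \<omega> = y} = (\<Union>x\<in>S. {\<omega>\<in>space M. X t \<omega> = y \<and> X 0 \<omega> = x})"
      using X0 by auto
    also have "prob \<dots> = (\<Sum>x\<in>S. prob {\<omega>\<in>space M. X t \<omega> = y \<and> X 0 \<omega> = x})"
      using S ev2 by (intro finite_measure_finite_Union) (auto simp: disjoint_family_on_def)
    also have "\<dots> = (\<Sum>x\<in>S. prob {\<omega>\<in>space M. X 0 \<omega> = x} * P t x y)"
      using joint[OF t _ y] by (intro sum.cong) auto
    finally show ?thesis .
  qed
  with P show ?thesis by (rule that)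
qed

text \<open>Each marginal is an initial law times a transition matrix. After relabelling by
  \<open>g\<close>, the initial weights agree by \<open>init\<close> and the matrices by
  uniqueness.\<close>

lemma markov_process_distr_eq:
  assumes X: "markov_process M S q X" and X': "markov_process M' S' q' X'"
    and g: "bij_betw g S S'" and fS: "\<And>x'. x' \<in> S' \<Longrightarrow> f x' \<in> S"
    and gf: "\<And>x'. x' \<in> S' \<Longrightarrow> g (f x') = x'" and fg: "\<And>x. x \<in> S \<Longrightarrow> f (g x) = x"
    and q: "\<And>x y. x \<in> S \<Longrightarrow> y \<in> S \<Longrightarrow> x \<noteq> y \<Longrightarrow> q x y = q' (g x) (g y)"
    and init: "distr M (count_space S) (X 0) = distr M' (count_space S) (\<lambda>\<omega>. f (X' 0 \<omega>))"
    and t: "t \<ge> 0"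
  shows "distr M (count_space S) (X t) = distr M' (count_space S) (\<lambda>\<omega>. f (X' t \<omega>))"
proof -
  interpret M: prob_space M by (rule markov_process_prob_space[OF X])
  interpret M': prob_space M' by (rule markov_process_prob_space[OF X'])
  note S = markov_process_finite[OF X] and meas = markov_process_measurable[OF X]
  note meas' = markov_process_measurable[OF X']
  have f: "f \<in> measurable (count_space S') (count_space S)" using fS by auto
  have meas_f: "(\<lambda>\<omega>. f (X' t \<omega>)) \<in> measurable M' (count_space S)" if "t \<ge> 0" for t
    by (rule measurable_compose[OF meas'[OF that] f])
  have gS: "g x \<in> S'" if "x \<in> S" for x using g that by (auto simp: bij_betw_def)
  have law: "measure (distr M (count_space S) (X t)) {x} = measure M {\<omega>\<in>space M. X t \<omega> = x}"
    if "t \<ge> 0" "x \<in> S" for t x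
    using that by (subst measure_distr[OF meas]) (auto intro!: arg_cong[where f = "measure M"])
  have law': "measure (distr M' (count_space S) (\<lambda>\<omega>. f (X' t \<omega>))) {x} =
      measure M' {\<omega>\<in>space M'. X' t \<omega> = g x}" if t: "t \<ge> 0" and x: "x \<in> S" for t x
  proof -
    \<comment> \<open>On \<open>S'\<close> the map \<open>f\<close> is inverse to \<open>g\<close>,
      so its fibre over \<open>x\<close> is the single state \<open>g x\<close>.\<close>
    have "(\<lambda>\<omega>. f (X' t \<omega>)) -` {x} \<inter> space M' = {\<omega>\<in>space M'. X' t \<omega> = g x}"
      using measurable_space[OF meas'[OF t]] gf fg[OF x] by auto
    then show ?thesis using x by (subst measure_distr[OF meas_f[OF t]]) auto
  qed
  obtain P where P: "transition_function S q P"
    and marg: "\<And>t y. t \<ge> 0 \<Longrightarrow> y \<in> S \<Longrightarrow> measure M {\<omega>\<in>space M. X t \<omega> = y} =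
      (\<Sum>x\<in>S. measure M {\<omega>\<in>space M. X 0 \<omega> = x} * P t x y)"
    using markov_process_marginal[OF X] by blast
  obtain Q where Q: "transition_function S' q' Q"
    and marg': "\<And>t y. t \<ge> 0 \<Longrightarrow> y \<in> S' \<Longrightarrow> measure M' {\<omega>\<in>space M'. X' t \<omega> = y} =
      (\<Sum>x\<in>S'. measure M' {\<omega>\<in>space M'. X' 0 \<omega> = x} * Q t x y)"
    using markov_process_marginal[OF X'] by blast
  have eq: "measure M {\<omega>\<in>space M. X t \<omega> = y} = measure M' {\<omega>\<in>space M'. X' t \<omega> = g y}"
    if y: "y \<in> S" for y
  proof -
    have "measure M' {\<omega>\<in>space M'. X' t \<omega> = g y} =
        (\<Sum>x\<in>S. measure M' {\<omega>\<in>space M'. X' 0 \<omega> = g x} * Q t (g x) (g y))"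
      unfolding marg'[OF t gS[OF y]] by (rule sum.reindex_bij_betw[OF g, symmetric])
    also have "\<dots> = (\<Sum>x\<in>S. measure M {\<omega>\<in>space M. X 0 \<omega> = x} * P t x y)"
    proof (rule sum.cong[OF refl])
      fix x assume x: "x \<in> S"
      have "P t x y = Q t (g x) (g y)"
        by (rule transition_function_unique[OF S P transition_function_reindex[OF Q g] q t x y])
      moreover have "measure M {\<omega>\<in>space M. X 0 \<omega> = x} = measure M' {\<omega>\<in>space M'. X' 0 \<omega> = g x}"
        using law[of 0 x] law'[of 0 x] x init by simp
      ultimately show "measure M' {\<omega>\<in>space M'. X' 0 \<omega> = g x} * Q t (g x) (g y) =
          measure M {\<omega>\<in>space M. X 0 \<omega> = x} * P t x y" by simp
    qed
    finally show ?thesis using marg[OF t y] by simp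
  qed
  interpret D: prob_space "distr M (count_space S) (X t)"
    by (rule M.prob_space_distr[OF meas[OF t]])
  interpret D': prob_space "distr M' (count_space S) (\<lambda>\<omega>. f (X' t \<omega>))"
    by (rule M'.prob_space_distr[OF meas_f[OF t]])
  show ?thesis
  \<comment> \<open>Laws on a finite state space are determined by their point masses.\<close>
  proof (rule measure_eqI_finite[where A = S])
    fix x assume "x \<in> S"
    then show "emeasure (distr M (count_space S) (X t)) {x} =
        emeasure (distr M' (count_space S) (\<lambda>\<omega>. f (X' t \<omega>))) {x}"
      using law[OF t] law'[OF t] eq
      by (simp add: D.emeasure_eq_measure D'.emeasure_eq_measure)
  qed (use S in auto)
qed

theorem mainTheorem1:
  fixes N C :: nat
    and E :: "nat \<Rightarrow> (nat \<times> nat) set"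
    and \<nu> \<mu> :: "nat \<Rightarrow> nat \<Rightarrow> real"
  assumes "C \<ge> 1"
    and "\<And>c. c \<in> {1..C} \<Longrightarrow> simple_graph {1..N} (E c)"
    and "\<And>i c. i \<in> {1..N} \<Longrightarrow> c \<in> {1..C} \<Longrightarrow> \<nu> i c > 0"
    and "\<And>i c. i \<in> {1..N} \<Longrightarrow> c \<in> {1..C} \<Longrightarrow> \<mu> i c > 0"
  shows "(\<forall>x\<in>virtual_states N C E. \<forall>y\<in>virtual_states N C E. x \<noteq> y \<longrightarrow>
            virtual_rate N C \<nu> \<mu> x y = multi_rate N C \<nu> \<mu> (virtual_map x) (virtual_map y)) \<and>
         (\<forall>(M :: 'a measure) (M' :: 'b measure) X X'.
            markov_process M (feasible_states N C E) (multi_rate N C \<nu> \<mu>) X \<longrightarrow>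
            markov_process M' (virtual_states N C E) (virtual_rate N C \<nu> \<mu>) X' \<longrightarrow>
            distr M (count_space (feasible_states N C E)) (X 0) =
              distr M' (count_space (feasible_states N C E)) (\<lambda>\<omega>. virtual_map (X' 0 \<omega>)) \<longrightarrow>
            (\<forall>t\<ge>0. distr M (count_space (feasible_states N C E)) (X t) =
              distr M' (count_space (feasible_states N C E)) (\<lambda>\<omega>. virtual_map (X' t \<omega>))))"
proof (intro conjI ballI allI impI)
  fix x y assume "x \<in> virtual_states N C E" "y \<in> virtual_states N C E"
  then show "virtual_rate N C \<nu> \<mu> x y = multi_rate N C \<nu> \<mu> (virtual_map x) (virtual_map y)"
    by (rule virtual_rate_eq_multi_rate)
next
  fix M :: "'a measure" and M' :: "'b measure" and X X' and t :: real
  assume X: "markov_process M (feasible_states N C E) (multi_rate N C \<nu> \<mu>) X"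
    and X': "markov_process M' (virtual_states N C E) (virtual_rate N C \<nu> \<mu>) X'"
    and init: "distr M (count_space (feasible_states N C E)) (X 0) =
      distr M' (count_space (feasible_states N C E)) (\<lambda>\<omega>. virtual_map (X' 0 \<omega>))"
    and t: "t \<ge> 0"
  \<comment> \<open>The rate identity read from the feasible side, by applying it at the preimages
    of \<open>u\<close> and \<open>v\<close>.\<close>
  have rate: "multi_rate N C \<nu> \<mu> u v =
      virtual_rate N C \<nu> \<mu> (virtual_inverse u) (virtual_inverse v)"
    if "u \<in> feasible_states N C E" "v \<in> feasible_states N C E" for u v
    using that[THEN virtual_inverse_in_virtual_states]
    by (simp only: virtual_rate_eq_multi_rate virtual_map_virtual_inverse)
  show "distr M (count_space (feasible_states N C E)) (X t) =
      distr M' (count_space (feasible_states N C E)) (\<lambda>\<omega>. virtual_map (X' t \<omega>))"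
    by (rule markov_process_distr_eq[where f = virtual_map and g = virtual_inverse, OF X X'])
      (simp_all add: bij_betw_virtual_inverse virtual_map_feasible virtual_inverse_virtual_map
        virtual_map_virtual_inverse rate init t)
qed

end
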